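(* For $m\in\{7,8,9\}$ one has $\gamma_m(K_1)=\frac{2}{3}$.
   Context: $K_1=\{(x_1,x_2,x_3)\in\mathbb{R}^3: |x_1|+|x_2|+|x_3|\le 1\}$ is the unit crosspolytope in three-dimensional Euclidean space $\mathbb{E}^3$. For a convex body (compact convex set with non-empty interior) $K\subset\mathbb{E}^n$ and a positive integer $m$, $\gamma_m(K)$ denotes the smallest positive number $\lambda$ such that $K$ can be covered by $m$ translates of $\lambda K$: $$\gamma_m(K)=\min\Big\{\lambda>0:\ \exists\,\boldsymbol u_1,\dots,\boldsymbol u_m\in\mathbb{E}^n \text{ such that } K\subseteq\bigcup_{i=1}^m(\lambda K+\boldsymbol u_i)\Big\}.$$ *)

theory Defs
  imports "HOL-Analysis.Analysis"
begin

definition convex_body :: "'a::euclidean_space set \<Rightarrow> bool" where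
  "convex_body K \<longleftrightarrow> compact K \<and> convex K \<and> interior K \<noteq> {}"

definition covered_by_translates :: "nat \<Rightarrow> 'a::euclidean_space set \<Rightarrow> real \<Rightarrow> bool" where
  "covered_by_translates m K l \<longleftrightarrow>
     (\<exists>u :: nat \<Rightarrow> 'a. K \<subseteq> (\<Union>i\<in>{1..m}. (\<lambda>x. l *\<^sub>R x + u i) ` K))"

(* This is the minimum itself, not an infimum; cover_functional_min below
   shows that it is attained for every convex body and every m > 0. *)
definition cover_functional :: "nat \<Rightarrow> 'a::euclidean_space set \<Rightarrow> real" where
  "cover_functional m K = (LEAST l. l > 0 \<and> covered_by_translates m K l)"

definition unit_crosspolytope :: "(real^3) set" where
  "unit_crosspolytope = {x. \<bar>x $ 1\<bar> + \<bar>x $ 2\<bar> + \<bar>x $ 3\<bar> \<le> 1}"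

lemma cover_functional_exists:
  fixes K :: "'a::euclidean_space set"
  assumes K: "convex_body K" and m: "m > 0"
  shows "\<exists>l. (l > 0 \<and> covered_by_translates m K l) \<and>
             (\<forall>l'. l' > 0 \<and> covered_by_translates m K l' \<longrightarrow> l \<le> l')"
proof -
  have cK: "compact K" and iK: "interior K \<noteq> {}"
    using K by (auto simp: convex_body_def)
  obtain B where B: "B > 0" "\<And>x. x \<in> K \<Longrightarrow> norm x \<le> B"
    using compact_imp_bounded[OF cK] by (auto simp: bounded_pos)
  define D :: "(real \<times> (nat \<Rightarrow> 'a)) set" where
    "D = {0..1} \<times> (\<Pi>\<^sub>E i\<in>UNIV. cball 0 (2 * B))"
  define G where "G = (\<lambda>(l, k). (l, l *\<^sub>R k)) ` ({0..1::real} \<times> K)"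
  define P where "P = (\<lambda>x i (p :: real \<times> (nat \<Rightarrow> 'a)). (fst p, x - snd p i) \<in> G)"
  define T where "T = D \<inter> (\<Inter>x\<in>K. \<Union>i\<in>{1..m}. {p. P x i p})"
  have "compact (\<Pi>\<^sub>E i\<in>(UNIV :: nat set). cball (0 :: 'a) (2 * B))"
    unfolding compactin_euclidean_iff[symmetric] euclidean_product_topology[symmetric]
    by (simp add: compactin_PiE)
  then have cD: "compact D" unfolding D_def by (intro compact_Times) auto
  have "compact G" unfolding G_def
    by (intro compact_continuous_image compact_Times cK)
       (auto simp: case_prod_beta intro!: continuous_intros)
  then have cG: "closed G" by (rule compact_imp_closed)
  have cont: "continuous_on UNIV (\<lambda>p :: real \<times> (nat \<Rightarrow> 'a). (fst p, x - snd p i))" for x i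
  proof -
    have "continuous_on UNIV (\<lambda>p :: real \<times> (nat \<Rightarrow> 'a). snd p i)"
      by (rule continuous_on_product_then_coordinatewise) (intro continuous_intros)
    then show ?thesis by (intro continuous_intros)
  qed
  have "closed {p. P x i p}" for x i
    using closed_vimage[OF cG cont[of x i]] by (simp add: P_def vimage_def)
  then have "closed (\<Inter>x\<in>K. \<Union>i\<in>{1..m}. {p. P x i p})"
    by (intro closed_INT closed_UN ballI) auto
  then have cT: "compact T" unfolding T_def by (rule compact_Int_closed[OF cD])
  have G_iff: "(l, v) \<in> G \<longleftrightarrow> l \<in> {0..1} \<and> v \<in> (\<lambda>k. l *\<^sub>R k) ` K" for l v
    by (auto simp: G_def)
  have T_intro: "\<exists>u. (l, u) \<in> T" if l: "0 < l" "l \<le> 1" and c: "covered_by_translates m K l" for l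
  proof -
    from c obtain u where u: "K \<subseteq> (\<Union>i\<in>{1..m}. (\<lambda>x. l *\<^sub>R x + u i) ` K)"
      by (auto simp: covered_by_translates_def)
    define w where "w i = (if norm (u i) \<le> 2 * B then u i else 0)" for i
    have "\<exists>i\<in>{1..m}. P x i (l, w)" if x: "x \<in> K" for x
    proof -
      from u x obtain i k where i: "i \<in> {1..m}" and k: "k \<in> K" and e: "x = l *\<^sub>R k + u i" by blast
      have "norm (l *\<^sub>R k) \<le> 1 * B"
        unfolding norm_scaleR by (intro mult_mono) (use l B k in auto)
      moreover have "u i = x - l *\<^sub>R k" using e by simp
      ultimately have "norm (u i) \<le> 2 * B"
        using norm_triangle_ineq4[of x "l *\<^sub>R k"] B(2)[OF x] by simp
      then have "w i = u i" by (simp add: w_def)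
      then have "P x i (l, w)" using l k e by (auto simp: P_def G_iff)
      then show ?thesis using i by blast
    qed
    moreover have "(l, w) \<in> D" using l B(1) by (auto simp: D_def w_def)
    ultimately have "(l, w) \<in> T" by (auto simp: T_def)
    then show ?thesis by blast
  qed
  have cov1: "covered_by_translates m K 1"
    unfolding covered_by_translates_def
    by (rule exI[of _ "\<lambda>_. 0"]) (use m in auto)
  then have ne: "T \<noteq> {}" using T_intro[of 1] by auto
  have "\<exists>p\<in>T. \<forall>q\<in>T. fst p \<le> fst q"
    by (rule continuous_attains_inf[OF cT ne]) (intro continuous_intros)
  then obtain l u where lu: "(l, u) \<in> T" and min: "\<And>q. q \<in> T \<Longrightarrow> l \<le> fst q" by force
  have l01: "0 \<le> l" "l \<le> 1" using lu by (auto simp: T_def D_def)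
  have sub: "K \<subseteq> (\<Union>i\<in>{1..m}. (\<lambda>x. l *\<^sub>R x + u i) ` K)"
  proof
    fix x assume "x \<in> K"
    then obtain i where i: "i \<in> {1..m}" "(l, x - u i) \<in> G" using lu by (auto simp: T_def P_def)
    then obtain k where "k \<in> K" "x - u i = l *\<^sub>R k" by (auto simp: G_iff)
    then have "x = l *\<^sub>R k + u i" by (simp add: algebra_simps)
    then show "x \<in> (\<Union>i\<in>{1..m}. (\<lambda>x. l *\<^sub>R x + u i) ` K)" using i \<open>k \<in> K\<close> by blast
  qed
  have "l \<noteq> 0"
  proof
    assume "l = 0"
    then have "K \<subseteq> u ` {1..m}" using sub by auto
    then have "finite K" by (rule finite_subset) auto
    then have "finite (interior K)" using interior_subset finite_subset by blast
    then show False using iK open_interior finite_imp_not_open by blast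
  qed
  then have "l > 0 \<and> covered_by_translates m K l"
    using l01 sub by (auto simp: covered_by_translates_def)
  moreover have "l \<le> l'" if "l' > 0" "covered_by_translates m K l'" for l'
  proof (cases "l' \<le> 1")
    case True
    then show ?thesis using T_intro[of l'] that min by force
  next
    case False
    then show ?thesis using l01 by simp
  qed
  ultimately show ?thesis by blast
qed

lemma cover_functional_min:
  fixes K :: "'a::euclidean_space set"
  assumes "convex_body K" and "m > 0"
  shows "cover_functional m K > 0"
    and "covered_by_translates m K (cover_functional m K)"
    and "\<And>l. l > 0 \<Longrightarrow> covered_by_translates m K l \<Longrightarrow> cover_functional m K \<le> l"
proof -
  obtain l where l: "l > 0 \<and> covered_by_translates m K l"
    "\<And>l'. l' > 0 \<and> covered_by_translates m K l' \<Longrightarrow> l \<le> l'"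
    using cover_functional_exists[OF assms] by blast
  have eq: "cover_functional m K = l"
    unfolding cover_functional_def by (rule Least_equality) (use l in auto)
  show "cover_functional m K > 0" "covered_by_translates m K (cover_functional m K)"
    "\<And>l. l > 0 \<Longrightarrow> covered_by_translates m K l \<Longrightarrow> cover_functional m K \<le> l"
    using l unfolding eq by auto
qed

lemma convex_body_unit_crosspolytope: "convex_body unit_crosspolytope"
proof -
  let ?f = "\<lambda>x :: real^3. \<bar>x $ 1\<bar> + \<bar>x $ 2\<bar> + \<bar>x $ 3\<bar>"
  have cont: "continuous_on UNIV ?f" by (intro continuous_intros)
  have "closed unit_crosspolytope"
    unfolding unit_crosspolytope_def by (intro closed_Collect_le continuous_intros)
  moreover have "norm x \<le> 1" if "x \<in> unit_crosspolytope" for x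
    using that norm_le_l1_cart[of x] by (simp add: unit_crosspolytope_def sum_3)
  then have "bounded unit_crosspolytope" by (auto simp: bounded_iff)
  ultimately have "compact unit_crosspolytope" by (simp add: compact_eq_bounded_closed)
  moreover have "convex unit_crosspolytope"
  proof (rule convexI)
    fix x y :: "real^3" and a b :: real
    assume xy: "x \<in> unit_crosspolytope" "y \<in> unit_crosspolytope" and ab: "0 \<le> a" "0 \<le> b" "a + b = 1"
    have "\<bar>a * x $ i + b * y $ i\<bar> \<le> a * \<bar>x $ i\<bar> + b * \<bar>y $ i\<bar>" for i
      using abs_triangle_ineq[of "a * x $ i" "b * y $ i"] ab by (simp add: abs_mult)
    then have "?f (a *\<^sub>R x + b *\<^sub>R y) \<le> (a * \<bar>x $ 1\<bar> + b * \<bar>y $ 1\<bar>) +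
        (a * \<bar>x $ 2\<bar> + b * \<bar>y $ 2\<bar>) + (a * \<bar>x $ 3\<bar> + b * \<bar>y $ 3\<bar>)"
      unfolding vector_add_component vector_scaleR_component real_scaleR_def
      by (intro add_mono) auto
    also have "\<dots> = a * ?f x + b * ?f y" by (simp add: algebra_simps)
    also have "\<dots> \<le> 1"
      using xy ab by (intro convex_bound_le) (auto simp: unit_crosspolytope_def)
    finally show "a *\<^sub>R x + b *\<^sub>R y \<in> unit_crosspolytope" by (simp add: unit_crosspolytope_def)
  qed
  moreover have "{x. ?f x < 1} \<subseteq> interior unit_crosspolytope"
    by (intro interior_maximal open_Collect_less continuous_intros)
       (auto simp: unit_crosspolytope_def)
  then have "0 \<in> interior unit_crosspolytope" by auto
  ultimately show ?thesis by (auto simp: convex_body_def)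
qed

end

theory Submission
  imports Defs
begin

text \<open>
  The crosspolytope is the closed unit ball of the taxicab norm, so a translate of
  \<open>l *\<^sub>R K\<close> is a taxicab ball of radius \<open>l\<close>, and covering numbers can be compared with
  packings of points.

  For the upper bound, six balls of radius \<open>2 / 3\<close> already suffice: centre them at the
  points one third of the way from the origin to each vertex. A point of the crosspolytope
  lies in the ball on the half-axis along which its coordinate is largest in absolute
  value (\<open>taxicab_shift_largest\<close>).

  For the lower bound, the six vertices together with the centres of four pairwise
  non-adjacent faces are ten points at mutual taxicab distance at least \<open>4 / 3\<close>
  (\<open>separated_points_far\<close>). A ball of radius \<open>l < 2 / 3\<close> has diameter less than \<open>4 / 3\<close>
  and so contains at most one of them, whence at least ten balls are needed
  (\<open>separated_length_le_cover\<close>). The two bounds meet for every number of translates from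
  six to nine.
\<close>

definition taxicab :: "real^3 \<Rightarrow> real" where
  "taxicab x = \<bar>x $ 1\<bar> + \<bar>x $ 2\<bar> + \<bar>x $ 3\<bar>"

lemma mem_unit_crosspolytope_iff: "x \<in> unit_crosspolytope \<longleftrightarrow> taxicab x \<le> 1"
  by (simp add: unit_crosspolytope_def taxicab_def)

lemma taxicab_scaleR: "taxicab (c *\<^sub>R x) = \<bar>c\<bar> * taxicab x"
  by (simp add: taxicab_def abs_mult algebra_simps)

lemma taxicab_diff_le: "taxicab (x - y) \<le> taxicab (x - u) + taxicab (y - u)"
  by (simp add: taxicab_def)

lemma mem_crosspolytope_translate_iff:
  assumes "l > 0"
  shows "x \<in> (\<lambda>y. l *\<^sub>R y + u) ` unit_crosspolytope \<longleftrightarrow> taxicab (x - u) \<le> l"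
proof
  assume "x \<in> (\<lambda>y. l *\<^sub>R y + u) ` unit_crosspolytope"
  then obtain y where "taxicab y \<le> 1" "x = l *\<^sub>R y + u"
    by (auto simp: mem_unit_crosspolytope_iff)
  then show "taxicab (x - u) \<le> l"
    using assms by (simp add: taxicab_scaleR)
next
  assume "taxicab (x - u) \<le> l"
  then have "(1 / l) *\<^sub>R (x - u) \<in> unit_crosspolytope"
    using assms by (simp add: mem_unit_crosspolytope_iff taxicab_scaleR)
  moreover have "x = l *\<^sub>R ((1 / l) *\<^sub>R (x - u)) + u"
    using assms by simp
  ultimately show "x \<in> (\<lambda>y. l *\<^sub>R y + u) ` unit_crosspolytope"
    by blast
qed

lemma covered_by_translates_list:
  assumes "length us \<le> m" and "K \<subseteq> (\<Union>u\<in>set us. (\<lambda>x. l *\<^sub>R x + u) ` K)"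
  shows "covered_by_translates m K l"
  unfolding covered_by_translates_def
proof (intro exI subsetI)
  fix x assume "x \<in> K"
  then obtain u where "u \<in> set us" and x: "x \<in> (\<lambda>x. l *\<^sub>R x + u) ` K"
    using assms(2) by blast
  then obtain i where "i < length us" "us ! i = u"
    by (auto simp: in_set_conv_nth)
  then show "x \<in> (\<Union>i\<in>{1..m}. (\<lambda>x. l *\<^sub>R x + us ! (i - 1)) ` K)"
    using x assms(1) by (intro UN_I[of "Suc i"]) auto
qed

definition third_vertices :: "(real^3) list" where
  "third_vertices =
    [vector [1/3, 0, 0], vector [-1/3, 0, 0],
     vector [0, 1/3, 0], vector [0, -1/3, 0],
     vector [0, 0, 1/3], vector [0, 0, -1/3]]"

text \<open>
  Let \<open>a\<close> be the largest of the three absolute values. Moving towards the corresponding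
  vertex by one third replaces \<open>a\<close> by \<open>\<bar>a - 1/3\<bar>\<close>. If \<open>a \<ge> 1/3\<close>, the norm drops by exactly
  \<open>1/3\<close>, to at most \<open>2/3\<close>. If \<open>a < 1/3\<close>, the new norm is \<open>1/3 - a\<close> plus the two smaller
  absolute values, one of which is at most \<open>a\<close> and the other at most \<open>1/3\<close>.
\<close>
lemma taxicab_shift_largest:
  assumes "taxicab x \<le> 1"
  shows "\<exists>u\<in>set third_vertices. taxicab (x - u) \<le> 2/3"
proof -
  consider "\<bar>x $ 2\<bar> \<le> \<bar>x $ 1\<bar>" "\<bar>x $ 3\<bar> \<le> \<bar>x $ 1\<bar>"
    | "\<bar>x $ 1\<bar> \<le> \<bar>x $ 2\<bar>" "\<bar>x $ 3\<bar> \<le> \<bar>x $ 2\<bar>"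
    | "\<bar>x $ 1\<bar> \<le> \<bar>x $ 3\<bar>" "\<bar>x $ 2\<bar> \<le> \<bar>x $ 3\<bar>"
    by linarith
  then show ?thesis
  proof cases
    case 1
    then have "taxicab (x - vector [1/3, 0, 0]) \<le> 2/3 \<or> taxicab (x - vector [-1/3, 0, 0]) \<le> 2/3"
      using assms by (simp add: taxicab_def) argo
    then show ?thesis
      by (auto simp: third_vertices_def)
  next
    case 2
    then have "taxicab (x - vector [0, 1/3, 0]) \<le> 2/3 \<or> taxicab (x - vector [0, -1/3, 0]) \<le> 2/3"
      using assms by (simp add: taxicab_def) argo
    then show ?thesis
      by (auto simp: third_vertices_def)
  next
    case 3
    then have "taxicab (x - vector [0, 0, 1/3]) \<le> 2/3 \<or> taxicab (x - vector [0, 0, -1/3]) \<le> 2/3"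
      using assms by (simp add: taxicab_def) argo
    then show ?thesis
      by (auto simp: third_vertices_def)
  qed
qed

lemma crosspolytope_covered_two_thirds:
  assumes "m \<ge> 6"
  shows "covered_by_translates m unit_crosspolytope (2/3)"
proof (rule covered_by_translates_list)
  show "length third_vertices \<le> m"
    using assms by (simp add: third_vertices_def)
  show "unit_crosspolytope \<subseteq> (\<Union>u\<in>set third_vertices. (\<lambda>x. (2/3) *\<^sub>R x + u) ` unit_crosspolytope)"
    using taxicab_shift_largest
    by (auto simp: mem_crosspolytope_translate_iff mem_unit_crosspolytope_iff)
qed

text \<open>
  Two points of one translate are at distance at most \<open>2 * l\<close>, so sending each point of a
  \<open>2 * l\<close>-separated family to a translate containing it is injective. The family is a list,
  so that separation in list order also yields that its members are distinct.
\<close>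
lemma separated_length_le_cover:
  assumes cov: "covered_by_translates m unit_crosspolytope l" and "l > 0"
    and sub: "set ps \<subseteq> unit_crosspolytope"
    and sep: "sorted_wrt (\<lambda>p q. 2 * l < taxicab (p - q)) ps"
  shows "length ps \<le> m"
proof -
  obtain u where u: "unit_crosspolytope \<subseteq> (\<Union>i\<in>{1..m}. (\<lambda>x. l *\<^sub>R x + u i) ` unit_crosspolytope)"
    using cov by (auto simp: covered_by_translates_def)
  have "\<exists>i\<in>{1..m}. taxicab (ps ! k - u i) \<le> l" if "k < length ps" for k
  proof -
    have "ps ! k \<in> unit_crosspolytope"
      using sub that by auto
    then obtain i where "i \<in> {1..m}" "ps ! k \<in> (\<lambda>x. l *\<^sub>R x + u i) ` unit_crosspolytope"
      using u by blast
    then show ?thesis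
      using \<open>l > 0\<close> by (auto simp only: mem_crosspolytope_translate_iff)
  qed
  then obtain f where f: "\<And>k. k < length ps \<Longrightarrow> f k \<in> {1..m}"
    "\<And>k. k < length ps \<Longrightarrow> taxicab (ps ! k - u (f k)) \<le> l"
    by metis
  have "inj_on f {..<length ps}"
  proof (rule linorder_inj_onI')
    fix j k assume jk: "j \<in> {..<length ps}" "k \<in> {..<length ps}" "j < k"
    then have "2 * l < taxicab (ps ! j - ps ! k)"
      using sep by (simp add: sorted_wrt_iff_nth_less)
    then show "f j \<noteq> f k"
      using f(2)[of j] f(2)[of k] jk taxicab_diff_le[of "ps ! j" "ps ! k" "u (f j)"] by auto
  qed
  then have "card {..<length ps} \<le> card {1..m}"
    by (rule card_inj_on_le) (use f(1) in auto)
  then show ?thesis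
    by simp
qed

text \<open>
  The vertices, and the centres of the faces whose sign pattern has an even number of
  minus signs. Two such faces differ in exactly two signs, which puts their centres at
  distance \<open>4/3\<close>; neighbouring faces, differing in one sign, would only give \<open>2/3\<close>.
\<close>
definition separated_points :: "(real^3) list" where
  "separated_points =
    [vector [1, 0, 0], vector [-1, 0, 0],
     vector [0, 1, 0], vector [0, -1, 0],
     vector [0, 0, 1], vector [0, 0, -1],
     vector [1/3, 1/3, 1/3], vector [1/3, -1/3, -1/3],
     vector [-1/3, 1/3, -1/3], vector [-1/3, -1/3, 1/3]]"

lemma separated_points_subset: "set separated_points \<subseteq> unit_crosspolytope"
  by (simp add: separated_points_def mem_unit_crosspolytope_iff taxicab_def)

lemma separated_points_far:
  "sorted_wrt (\<lambda>p q. 4/3 \<le> taxicab (p - q)) separated_points"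
  by (simp add: separated_points_def taxicab_def)

lemma crosspolytope_cover_ge_two_thirds:
  assumes cov: "covered_by_translates m unit_crosspolytope l" and "l > 0" and "m \<le> 9"
  shows "2/3 \<le> l"
proof (rule ccontr)
  assume "\<not> 2/3 \<le> l"
  then have "sorted_wrt (\<lambda>p q. 2 * l < taxicab (p - q)) separated_points"
    by (intro sorted_wrt_mono_rel[OF _ separated_points_far]) auto
  then have "length separated_points \<le> m"
    by (rule separated_length_le_cover[OF cov \<open>l > 0\<close> separated_points_subset])
  then show False
    using \<open>m \<le> 9\<close> by (simp add: separated_points_def)
qed

theorem theorem1p3:
  fixes m :: nat
  assumes "m \<in> {7, 8, 9}"
  shows "cover_functional m unit_crosspolytope = 2 / 3"
proof (rule antisym)
  have m: "m > 0" "6 \<le> m" "m \<le> 9"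
    using assms by auto
  note min = cover_functional_min[OF convex_body_unit_crosspolytope m(1)]
  show "cover_functional m unit_crosspolytope \<le> 2 / 3"
    by (rule min(3)) (simp_all add: crosspolytope_covered_two_thirds m)
  show "2 / 3 \<le> cover_functional m unit_crosspolytope"
    by (rule crosspolytope_cover_ge_two_thirds[OF min(2) min(1) m(3)])
qed

end
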